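(* Let $\beta\in[0,1]$ and $0<r<1$. If $f\in\mathcal{A}_\beta$, then for $|z|=r$ the following hold: (i) $-\dfrac{\tilde f(-r)}{r}\le\operatorname{Re}\left(\dfrac{f(z)}{z}\right)\le\dfrac{\tilde f(r)}{r}$; (ii) $-\tilde f(-r)\le|f(z)|\le\tilde f(r)$. All these estimates are sharp.
   Context: $\mathbb{D}=\{z\in\mathbb{C}:|z|<1\}$. $\mathcal{A}$ is the class of holomorphic functions $f$ on $\mathbb{D}$ of the form $f(z)=z+\sum_{n=2}^\infty a_n z^n$. For $\beta\in[0,1]$, $\mathcal{A}_\beta=\{f\in\mathcal{A}:\operatorname{Re}(\beta \frac{f(z)}{z}+(1-\beta)f'(z))>0 \text{ for all } z\in\mathbb{D}\}$, where $f(z)/z$ takes the value $1$ at $z=0$. The function $\tilde f$ on $\mathbb{D}$ is $\tilde f(z)=z+\sum_{n=2}^\infty\frac{2}{n-(n-1)\beta}z^n$, which for $\beta\in[0,1)$ equals $z\left(-1+2\,{}_2F_1\left[1,\frac1{1-\beta};\frac{2-\beta}{1-\beta};z\right]\right)$ (Gauss hypergeometric function). Sharp means that equality is attained for some $f\in\mathcal{A}_\beta$ and some $z$ with $|z|=r$. *)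

theory Defs
  imports "HOL-Complex_Analysis.Complex_Analysis"
begin

text \<open>Functions on the unit disc are represented by total functions; their values outside
  \<open>ball 0 1\<close> play no role.\<close>

definition class_A :: "(complex \<Rightarrow> complex) set" where
  "class_A = {f. f holomorphic_on ball 0 1 \<and>
     (\<exists>a :: nat \<Rightarrow> complex. \<forall>z\<in>ball 0 1. (\<lambda>n. a (n + 2) * z ^ (n + 2)) sums (f z - z))}"

definition class_A_beta :: "real \<Rightarrow> (complex \<Rightarrow> complex) set" where
  "class_A_beta \<beta> = {f \<in> class_A. \<forall>z\<in>ball 0 1.
     Re (of_real \<beta> * (if z = 0 then 1 else f z / z) + of_real (1 - \<beta>) * deriv f z) > 0}"

text \<open>The series is indexed from \<open>n = 0\<close>; the \<open>n\<close>-th summand is the term of degree \<open>n + 2\<close>.\<close>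

definition f_tilde :: "real \<Rightarrow> complex \<Rightarrow> complex" where
  "f_tilde \<beta> z = z + (\<Sum>n. of_real (2 / (real (n + 2) - real (n + 1) * \<beta>)) * z ^ (n + 2))"

lemma f_tilde_denom_ge_1:
  assumes "\<beta> \<in> {0..1}"
  shows "real (n + 2) - real (n + 1) * \<beta> \<ge> 1"
proof -
  have "real (n + 2) - real (n + 1) * \<beta> = 1 + real (n + 1) * (1 - \<beta>)"
    by (simp add: algebra_simps)
  moreover have "real (n + 1) * (1 - \<beta>) \<ge> 0"
    using assms by (intro mult_nonneg_nonneg) auto
  ultimately show ?thesis by linarith
qed

lemma f_tilde_summable:
  assumes "\<beta> \<in> {0..1}" "norm z < 1"
  shows "summable (\<lambda>n. of_real (2 / (real (n + 2) - real (n + 1) * \<beta>)) * (z :: complex) ^ (n + 2))"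
proof (rule summable_comparison_test')
  show "summable (\<lambda>n. 2 * norm z ^ (n + 2))"
    using assms(2) by (intro summable_mult summable_ignore_initial_segment summable_geometric) simp
next
  fix n :: nat
  let ?d = "real (n + 2) - real (n + 1) * \<beta>"
  have d: "?d \<ge> 1" using f_tilde_denom_ge_1[OF assms(1)] .
  then have "2 / ?d \<le> 2" by (simp add: field_simps)
  then have "\<bar>2 / ?d\<bar> \<le> 2" using d by simp
  then show "norm (of_real (2 / ?d) * z ^ (n + 2)) \<le> 2 * norm z ^ (n + 2)"
    unfolding norm_mult norm_of_real norm_power by (intro mult_right_mono) auto
qed

text \<open>On the real diameter \<open>f_tilde \<beta>\<close> is real-valued, so that nothing is lost by
  writing \<open>Re (f_tilde \<beta> (of_real x))\<close> for its real value there.\<close>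

lemma f_tilde_real:
  assumes "\<beta> \<in> {0..1}" "\<bar>x\<bar> < 1"
  shows "of_real (Re (f_tilde \<beta> (of_real x))) = f_tilde \<beta> (of_real x)"
proof -
  let ?t = "\<lambda>n. of_real (2 / (real (n + 2) - real (n + 1) * \<beta>)) * (of_real x :: complex) ^ (n + 2)"
  have "?t sums (\<Sum>n. ?t n)"
    using f_tilde_summable[OF assms(1)] assms(2) by (intro summable_sums) simp
  then have "(\<lambda>n. Im (?t n)) sums Im (\<Sum>n. ?t n)" by (rule sums_Im)
  moreover have "Im (?t n) = 0" for n
    unfolding of_real_power[symmetric] of_real_mult[symmetric] by (rule Im_complex_of_real)
  ultimately have "(\<lambda>n. 0) sums Im (\<Sum>n. ?t n)" by (simp only:)
  then have "Im (\<Sum>n. ?t n) = 0" using sums_unique2 sums_zero by blast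
  then show ?thesis unfolding f_tilde_def by (simp add: complex_eq_iff)
qed

end

theory Submission
  imports Defs
begin

text \<open>
  Put \<open>\<gamma> = 1 - \<beta>\<close> and write \<open>f z = z * g z\<close>. Since \<open>deriv f z = g z + z * deriv g z\<close>, the expression
  defining the class becomes the Euler-type operator \<open>T g z = g z + \<gamma> * z * deriv g z\<close>. So a
  normalized \<open>f\<close> belongs to the class exactly when \<open>p = T g\<close> is a Caratheodory function:
  \<open>p 0 = 1\<close> and \<open>Re p > 0\<close> on the disc. The Schwarz lemma gives the classical sharp bounds
  \<open>(1 - \<rho>) / (1 + \<rho>) \<le> Re (p z)\<close> and \<open>cmod (p z) \<le> (1 + \<rho>) / (1 - \<rho>)\<close> for \<open>\<rho> = cmod z\<close>.
  For \<open>G z = f_tilde \<beta> z / z\<close> the series can be differentiated termwise, and \<open>\<gamma>\<close> enters its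
  coefficients in such a way that \<open>T G z = (1 + z) / (1 - z)\<close>, the function for which the
  upper bound is an equality on the positive and the lower bound on the negative real radius.

  It remains to transfer inequalities from \<open>T q\<close> to \<open>q\<close>. One could invert \<open>T\<close> by the average
  of \<open>p (s * z)\<close> over \<open>0 < s < 1\<close> with the positive weight \<open>s powr (1 / \<gamma> - 1) / \<gamma>\<close>, but
  positivity of the inverse needs no formula: on \<open>{0..r}\<close> the real function \<open>d t = Re (q t)\<close> satisfies
  \<open>d t + \<gamma> * t * d' t \<ge> 0\<close>, whereas at a negative minimum the first summand would be
  negative and the second nonpositive (lemma \<open>nonneg_of_euler_inequality\<close>). This argument also covers \<open>\<gamma> = 0\<close>. As \<open>T\<close> is linear
  and commutes with \<open>z \<mapsto> u * z\<close>, comparing a rotated \<open>g\<close> with \<open>G\<close> and with \<open>z \<mapsto> G (- z)\<close> proves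
  an upper bound for \<open>cmod (g z)\<close> and a lower bound for \<open>Re (g z)\<close> (lemma
  \<open>caratheodory_transfer\<close>); the other two estimates follow from these by \<open>Re w \<le> cmod w\<close>.
  The function \<open>f_tilde \<beta>\<close> belongs to the class itself and attains the upper bounds at \<open>r\<close> and
  the lower bounds at \<open>- r\<close>.
\<close>

section \<open>Positivity of the inverse Euler-type operator\<close>

text \<open>At a point \<open>t > 0\<close> where \<open>d\<close> attains a negative minimum over \<open>{0..r}\<close>, minimality on the left
  forces \<open>d' t \<le> 0\<close>, so \<open>d t + \<gamma> * t * d' t\<close> would be negative; at \<open>t = 0\<close> the inequality is
  \<open>d 0 \<ge> 0\<close> itself.\<close>

lemma nonneg_of_euler_inequality:
  fixes d d' :: "real \<Rightarrow> real"
  assumes "0 \<le> \<gamma>" and "0 \<le> r"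
    and der: "\<And>t. t \<in> {0..r} \<Longrightarrow> (d has_real_derivative d' t) (at t)"
    and ineq: "\<And>t. t \<in> {0..r} \<Longrightarrow> 0 \<le> d t + \<gamma> * t * d' t"
  shows "0 \<le> d r"
proof (rule ccontr)
  assume "\<not> 0 \<le> d r"
  have "continuous_on {0..r} d"
    by (rule DERIV_continuous_on[where D = d'])
      (use der in \<open>blast intro: has_field_derivative_at_within\<close>)
  then obtain m where m: "m \<in> {0..r}" and min: "\<And>t. t \<in> {0..r} \<Longrightarrow> d m \<le> d t"
    using continuous_attains_inf[of "{0..r}" d] \<open>0 \<le> r\<close> by auto
  have neg: "d m < 0"
    using min[of r] \<open>0 \<le> r\<close> \<open>\<not> 0 \<le> d r\<close> by simp
  have "m \<noteq> 0"
    using ineq[of 0] neg \<open>0 \<le> r\<close> by auto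
  then have "m > 0"
    using m by simp
  have "d' m \<le> 0"
  proof (rule ccontr)
    assume "\<not> d' m \<le> 0"
    then obtain \<delta> where \<delta>: "\<delta> > 0" "\<And>h. 0 < h \<Longrightarrow> h < \<delta> \<Longrightarrow> d (m - h) < d m"
      using DERIV_pos_inc_left[OF der[OF m]] by force
    define h where "h = min (\<delta> / 2) m"
    have "0 < h" "h < \<delta>" "m - h \<in> {0..r}"
      using \<delta>(1) \<open>m > 0\<close> m by (auto simp: h_def)
    then show False
      using \<delta>(2)[of h] min[of "m - h"] by simp
  qed
  then have "\<gamma> * m * d' m \<le> 0"
    using \<open>0 \<le> \<gamma>\<close> \<open>m > 0\<close> by (intro mult_nonneg_nonpos) auto
  then show False
    using ineq[OF m] neg by simp
qed

definition euler_op :: "real \<Rightarrow> (complex \<Rightarrow> complex) \<Rightarrow> complex \<Rightarrow> complex" where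
  "euler_op \<gamma> q z = q z + of_real \<gamma> * z * deriv q z"

lemma euler_op_diff:
  assumes "q holomorphic_on ball 0 1" "h holomorphic_on ball 0 1" "z \<in> ball 0 1"
  shows "euler_op \<gamma> (\<lambda>w. q w - h w) z = euler_op \<gamma> q z - euler_op \<gamma> h z"
proof -
  have "q field_differentiable at z" "h field_differentiable at z"
    using assms holomorphic_on_imp_differentiable_at by blast+
  then show ?thesis
    by (simp add: euler_op_def algebra_simps)
qed

lemma euler_op_scale:
  assumes "q holomorphic_on ball 0 1" "u * z \<in> ball 0 1"
  shows "euler_op \<gamma> (\<lambda>w. c * q (u * w)) z = c * euler_op \<gamma> q (u * z)"
proof -
  have "(q has_field_derivative deriv q (u * z)) (at (u * z))"
    using assms holomorphic_derivI open_ball by blast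
  moreover have "((\<lambda>w. u * w) has_field_derivative u) (at z)"
    using DERIV_cmult_Id by simp
  ultimately have "((\<lambda>w. c * q (u * w)) has_field_derivative c * (deriv q (u * z) * u)) (at z)"
    by (intro DERIV_cmult DERIV_chain2[where g = "\<lambda>w. u * w"])
  then have "deriv (\<lambda>w. c * q (u * w)) z = c * (deriv q (u * z) * u)"
    by (rule DERIV_imp_deriv)
  then show ?thesis
    by (simp add: euler_op_def algebra_simps)
qed

lemma holomorphic_on_ball_scale:
  fixes u :: complex
  assumes "q holomorphic_on ball 0 1" "cmod u \<le> 1"
  shows "(\<lambda>w. c * q (u * w)) holomorphic_on ball 0 1"
proof -
  have "cmod (u * w) < 1" if "cmod w < 1" for w
    using mult_left_le_one_le[of "cmod w" "cmod u"] assms(2) that by (simp add: norm_mult)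
  then have "(q \<circ> (\<lambda>w. u * w)) holomorphic_on ball 0 1"
    by (intro holomorphic_on_compose_gen[OF _ assms(1)] holomorphic_intros) auto
  then show ?thesis
    by (auto simp: o_def intro: holomorphic_intros)
qed

lemma Re_nonneg_of_euler_op:
  assumes hol: "q holomorphic_on ball 0 1" and "0 \<le> \<gamma>" "0 \<le> r" "r < 1"
    and pos: "\<And>t. t \<in> {0..r} \<Longrightarrow> 0 \<le> Re (euler_op \<gamma> q (of_real t))"
  shows "0 \<le> Re (q (of_real r))"
proof (rule nonneg_of_euler_inequality[where \<gamma> = \<gamma> and d = "\<lambda>t. Re (q (of_real t))"
      and d' = "\<lambda>t. Re (deriv q (of_real t))"])
  fix t assume t: "t \<in> {0..r}"
  then have "(of_real t :: complex) \<in> ball 0 1"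
    using \<open>r < 1\<close> by simp
  then have "(q has_field_derivative deriv q (of_real t)) (at (of_real t))"
    using hol holomorphic_derivI open_ball by blast
  then show "((\<lambda>t. Re (q (of_real t))) has_real_derivative Re (deriv q (of_real t))) (at t)"
    by (intro has_field_derivative_Re has_vector_derivative_real_field)
  show "0 \<le> Re (q (of_real t)) + \<gamma> * t * Re (deriv q (of_real t))"
    using pos[OF t] by (simp add: euler_op_def mult.assoc)
qed (use assms in auto)

section \<open>Caratheodory functions\<close>

text \<open>The Cayley transform \<open>w = (p - 1) / (p + 1)\<close> maps the right half-plane to the disc, and the
  Schwarz lemma applied to \<open>w\<close> says \<open>cmod (p - 1) \<le> \<rho> * cmod (p + 1)\<close>. Both bounds
  can be read off from this disc of Apollonius.\<close>

lemma caratheodory_bounds: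
  assumes hol: "p holomorphic_on ball 0 1" and p0: "p 0 = 1"
    and pos: "\<And>z. z \<in> ball 0 1 \<Longrightarrow> 0 < Re (p z)" and z: "cmod z < 1"
  shows "cmod (p z) \<le> (1 + cmod z) / (1 - cmod z)"
    and "(1 - cmod z) / (1 + cmod z) \<le> Re (p z)"
proof -
  have ne: "p w + 1 \<noteq> 0" if "w \<in> ball 0 1" for w
    using pos[OF that] by (auto simp: complex_eq_iff)
  have lt: "cmod (p w - 1) < cmod (p w + 1)" if "w \<in> ball 0 1" for w
    using pos[OF that] unfolding cmod_def by (simp add: power2_eq_square algebra_simps)
  have "cmod ((p z - 1) / (p z + 1)) \<le> cmod z"
  proof (rule Schwarz_Lemma(1)[where f = "\<lambda>w. (p w - 1) / (p w + 1)"])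
    show "(\<lambda>w. (p w - 1) / (p w + 1)) holomorphic_on ball 0 1"
      using hol ne by (intro holomorphic_intros) auto
    show "cmod ((p w - 1) / (p w + 1)) < 1" if "cmod w < 1" for w
      using lt[of w] ne[of w] that by (simp add: norm_divide)
  qed (use p0 z in auto)
  then have key: "cmod (p z - 1) \<le> cmod z * cmod (p z + 1)"
    using ne[of z] z by (simp add: norm_divide field_simps)
  have "cmod (p z) - 1 \<le> cmod (p z - 1)"
    using norm_triangle_ineq2[of "p z" 1] by simp
  also note key
  also have "cmod z * cmod (p z + 1) \<le> cmod z * (cmod (p z) + 1)"
    using norm_triangle_ineq[of "p z" 1] by (intro mult_left_mono) auto
  finally show "cmod (p z) \<le> (1 + cmod z) / (1 - cmod z)"
    using z by (simp add: field_simps)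
  \<comment> \<open>Both \<open>p z - 1\<close> and \<open>p z + 1\<close> have the imaginary part of \<open>p z\<close>; as \<open>cmod z < 1\<close>, dropping it
    preserves the inequality.\<close>
  have "(cmod (p z - 1))\<^sup>2 \<le> (cmod z * cmod (p z + 1))\<^sup>2"
    using key by (intro power_mono) auto
  then have "(Re (p z) - 1)\<^sup>2 + (Im (p z))\<^sup>2
      \<le> (cmod z)\<^sup>2 * (Re (p z) + 1)\<^sup>2 + (cmod z)\<^sup>2 * (Im (p z))\<^sup>2"
    by (simp add: cmod_power2 power_mult_distrib distrib_left)
  moreover have "(cmod z)\<^sup>2 * (Im (p z))\<^sup>2 \<le> (Im (p z))\<^sup>2"
    using z by (intro mult_left_le_one_le) (auto simp: power_le_one)
  ultimately have "(Re (p z) - 1)\<^sup>2 \<le> (cmod z * (Re (p z) + 1))\<^sup>2"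
    by (simp add: power_mult_distrib)
  moreover have "0 \<le> cmod z * (Re (p z) + 1)"
    using pos[of z] z by simp
  ultimately have "\<bar>Re (p z) - 1\<bar> \<le> cmod z * (Re (p z) + 1)"
    by (metis abs_le_square_iff abs_of_nonneg)
  then have "1 - Re (p z) \<le> cmod z * (Re (p z) + 1)"
    by simp
  moreover have "0 < 1 + cmod z"
    using norm_ge_zero[of z] by linarith
  ultimately show "(1 - cmod z) / (1 + cmod z) \<le> Re (p z)"
    by (simp add: pos_divide_le_eq algebra_simps)
qed

section \<open>The extremal function\<close>

text \<open>With \<open>\<gamma> = 1 - \<beta>\<close>, the denominator \<open>n + 1 - n * \<beta>\<close> of the coefficient of degree \<open>n + 1\<close> in
  \<open>f_tilde \<beta>\<close> is \<open>1 + \<gamma> * n\<close>; these are the coefficients after division by \<open>z\<close>.\<close>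

definition extremal_coeff :: "real \<Rightarrow> nat \<Rightarrow> real" where
  "extremal_coeff \<gamma> n = (if n = 0 then 1 else 2 / (1 + \<gamma> * real n))"

definition extremal_quotient :: "real \<Rightarrow> complex \<Rightarrow> complex" where
  "extremal_quotient \<gamma> z = (\<Sum>n. of_real (extremal_coeff \<gamma> n) * z ^ n)"

lemma extremal_quotient_sums:
  assumes "0 \<le> \<gamma>" "cmod z < 1"
  shows "(\<lambda>n. of_real (extremal_coeff \<gamma> n) * z ^ n) sums extremal_quotient \<gamma> z"
  unfolding extremal_quotient_def
proof (rule summable_sums, rule summable_comparison_test')
  show "summable (\<lambda>n. 2 * cmod z ^ n)"
    using assms by (intro summable_mult summable_geometric) simp
  fix n :: nat
  have "0 \<le> \<gamma> * real n"
    using assms by simp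
  then have "\<bar>extremal_coeff \<gamma> n\<bar> \<le> 2"
    by (auto simp: extremal_coeff_def field_simps)
  then show "cmod (of_real (extremal_coeff \<gamma> n) * z ^ n) \<le> 2 * cmod z ^ n"
    by (simp add: norm_mult norm_power mult_right_mono)
qed

lemma extremal_quotient_holomorphic:
  assumes "0 \<le> \<gamma>"
  shows "extremal_quotient \<gamma> holomorphic_on ball 0 1"
  by (rule power_series_holomorphic[where a = "\<lambda>n. of_real (extremal_coeff \<gamma> n)"])
    (use extremal_quotient_sums[OF assms] in auto)

lemma extremal_quotient_0 [simp]: "extremal_quotient \<gamma> 0 = 1"
  by (simp add: extremal_quotient_def extremal_coeff_def powser_zero)

text \<open>Termwise, the operator multiplies the \<open>n\<close>-th coefficient by \<open>1 + \<gamma> * n\<close>, which cancels its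
  denominator and leaves \<open>1 + 2 * (z + z ^ 2 + \<dots>)\<close>.\<close>

lemma euler_op_extremal_quotient:
  assumes "0 \<le> \<gamma>" "cmod z < 1"
  shows "euler_op \<gamma> (extremal_quotient \<gamma>) z = (1 + z) / (1 - z)"
proof -
  let ?b = "\<lambda>n. complex_of_real (extremal_coeff \<gamma> n)"
  have "(extremal_quotient \<gamma> has_field_derivative deriv (extremal_quotient \<gamma>) z) (at z)"
    using extremal_quotient_holomorphic[OF assms(1)] assms(2)
    by (intro holomorphic_derivI[of _ "ball 0 1"]) auto
  then have d: "(\<lambda>n. diffs ?b n * z ^ n) sums deriv (extremal_quotient \<gamma>) z"
    using extremal_quotient_sums[OF assms(1)] assms(2)
    by (intro termdiffs_sums_strong[where K = 1 and f = "extremal_quotient \<gamma>"]) auto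
  have "(\<lambda>n. of_nat (Suc n) * ?b (Suc n) * z ^ Suc n) sums (z * deriv (extremal_quotient \<gamma>) z)"
    using sums_mult[OF d, of z] by (simp add: diffs_def mult_ac)
  from sums_Suc[of "\<lambda>n. of_nat n * ?b n * z ^ n", OF this]
  have "(\<lambda>n. of_nat n * ?b n * z ^ n) sums (z * deriv (extremal_quotient \<gamma>) z)"
    by simp
  from sums_add[OF extremal_quotient_sums[OF assms] sums_mult[OF this, of "of_real \<gamma>"]]
  have "(\<lambda>n. ?b n * (1 + of_real \<gamma> * of_nat n) * z ^ n) sums euler_op \<gamma> (extremal_quotient \<gamma>) z"
    by (simp add: euler_op_def algebra_simps)
  moreover have "?b n * (1 + of_real \<gamma> * of_nat n) * z ^ n = 2 * z ^ n - (if n = 0 then 1 else 0)"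
    for n
  proof (cases "n = 0")
    case False
    have "0 \<le> \<gamma> * real n"
      using assms by simp
    then have "1 + \<gamma> * real n \<noteq> 0"
      by linarith
    then have "extremal_coeff \<gamma> n * (1 + \<gamma> * real n) = 2"
      using False by (simp add: extremal_coeff_def del: distrib_left_numeral)
    then have "?b n * (1 + of_real \<gamma> * of_nat n) = 2"
      by (metis of_real_1 of_real_add of_real_mult of_real_numeral of_real_of_nat_eq)
    then show ?thesis
      using False by simp
  qed (simp add: extremal_coeff_def)
  ultimately have "(\<lambda>n. 2 * z ^ n - (if n = 0 then 1 else 0)) sums euler_op \<gamma> (extremal_quotient \<gamma>) z"
    by simp
  moreover have "(\<lambda>n. 2 * z ^ n - (if n = 0 then 1 else 0)) sums (2 * (1 / (1 - z)) - 1)"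
    using sums_single[of 0 "\<lambda>_. 1 :: complex"] assms(2)
    by (intro sums_diff sums_mult geometric_sums) auto
  ultimately have "euler_op \<gamma> (extremal_quotient \<gamma>) z = 2 * (1 / (1 - z)) - 1"
    using sums_unique2 by blast
  also have "\<dots> = (1 + z) / (1 - z)"
  proof -
    have "1 - z \<noteq> 0"
      using assms(2) by auto
    then show ?thesis
      by (simp add: field_simps)
  qed
  finally show ?thesis .
qed

lemma f_tilde_eq:
  assumes "\<beta> \<in> {0..1}" "cmod z < 1"
  shows "f_tilde \<beta> z = z * extremal_quotient (1 - \<beta>) z"
proof -
  let ?b = "\<lambda>n. complex_of_real (extremal_coeff (1 - \<beta>) n)"
  have "(\<lambda>n. z * (?b n * z ^ n)) sums (z * extremal_quotient (1 - \<beta>) z)"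
    using assms by (intro sums_mult extremal_quotient_sums) auto
  then have "(\<lambda>n. ?b (Suc n) * z ^ (n + 2)) sums (z * extremal_quotient (1 - \<beta>) z - z)"
    using sums_Suc_iff[of "\<lambda>n. z * (?b n * z ^ n)" "z * extremal_quotient (1 - \<beta>) z - z"]
    by (simp add: extremal_coeff_def mult_ac)
  moreover have "extremal_coeff (1 - \<beta>) (Suc n) = 2 / (real (n + 2) - real (n + 1) * \<beta>)" for n
    by (simp add: extremal_coeff_def algebra_simps)
  ultimately show ?thesis
    unfolding f_tilde_def by (simp add: sums_unique[symmetric])
qed

section \<open>The class in terms of the quotient\<close>

lemma class_expression_eq_euler_op:
  assumes hol: "g holomorphic_on ball 0 1" and "g 0 = 1"
    and f: "\<And>w. w \<in> ball 0 1 \<Longrightarrow> f w = w * g w" and z: "z \<in> ball 0 1"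
  shows "of_real \<beta> * (if z = 0 then 1 else f z / z) + of_real (1 - \<beta>) * deriv f z
    = euler_op (1 - \<beta>) g z"
proof -
  have "(g has_field_derivative deriv g z) (at z)"
    using hol z holomorphic_derivI open_ball by blast
  then have "((\<lambda>w. w * g w) has_field_derivative g z + z * deriv g z) (at z)"
    by (auto intro!: derivative_eq_intros)
  then have "(f has_field_derivative g z + z * deriv g z) (at z)"
    by (rule has_field_derivative_transform_within_open[of _ _ _ "ball 0 1"]) (use f z in auto)
  then have "deriv f z = g z + z * deriv g z"
    by (rule DERIV_imp_deriv)
  moreover have "(if z = 0 then 1 else f z / z) = g z"
    using f[OF z] \<open>g 0 = 1\<close> by simp
  ultimately show ?thesis
    by (simp add: euler_op_def algebra_simps)
qed

text \<open>Dividing the power series of \<open>f\<close> by \<open>z\<close> gives a power series for the quotient that converges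
  on the whole disc, so the singularity at \<open>0\<close> is removable with value \<open>1\<close>.\<close>

lemma class_A_quotient:
  assumes "f \<in> class_A"
  obtains g where "g holomorphic_on ball 0 1" "g 0 = 1" "\<And>z. z \<in> ball 0 1 \<Longrightarrow> f z = z * g z"
proof -
  from assms obtain a :: "nat \<Rightarrow> complex"
    where a: "\<And>z. z \<in> ball 0 1 \<Longrightarrow> (\<lambda>n. a (n + 2) * z ^ (n + 2)) sums (f z - z)"
    unfolding class_A_def by blast
  define g where "g z = (if z = 0 then 1 else f z / z)" for z
  define c where "c n = (if n = 0 then 1 else a (n + 1))" for n
  have g_sums: "(\<lambda>n. c n * z ^ n) sums g z" if z: "z \<in> ball 0 1" for z
  proof (cases "z = 0")
    case True
    then show ?thesis
      using powser_sums_zero[of c] by (simp add: c_def g_def)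
  next
    case False
    have "(\<lambda>n. a (n + 2) * z ^ (n + 2) / z) sums ((f z - z) / z)"
      by (rule sums_divide[OF a[OF z]])
    then have "(\<lambda>n. c (Suc n) * z ^ Suc n) sums (g z - 1)"
      using False by (simp add: c_def g_def diff_divide_distrib)
    from sums_Suc[of "\<lambda>n. c n * z ^ n", OF this] show ?thesis
      by (simp add: c_def)
  qed
  show thesis
  proof
    show "g holomorphic_on ball 0 1"
      by (rule power_series_holomorphic[where a = c]) (use g_sums in simp)
    show "g 0 = 1"
      by (simp add: g_def)
    fix z :: complex
    assume z: "z \<in> ball 0 1"
    have "f 0 = 0"
      using sums_unique2[OF a[of 0], of 0] by simp
    then show "f z = z * g z"
      by (simp add: g_def)
  qed
qed

text \<open>The function \<open>(1 + z) / (1 - z)\<close> maps the disc into the right half-plane, because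
  \<open>(1 + z) * cnj (1 - z)\<close> has real part \<open>1 - (cmod z)\<^sup>2\<close>.\<close>

lemma f_tilde_in_class:
  assumes "\<beta> \<in> {0..1}"
  shows "f_tilde \<beta> \<in> class_A_beta \<beta>"
proof -
  let ?G = "extremal_quotient (1 - \<beta>)"
  have hol: "?G holomorphic_on ball 0 1"
    using assms by (intro extremal_quotient_holomorphic) auto
  have eq: "f_tilde \<beta> z = z * ?G z" if "z \<in> ball 0 1" for z
    using f_tilde_eq[OF assms] that by simp
  have "(\<lambda>z. z * ?G z) holomorphic_on ball 0 1"
    using hol by (intro holomorphic_intros)
  then have "f_tilde \<beta> holomorphic_on ball 0 1"
    by (subst holomorphic_cong[OF refl eq])
  moreover have "(\<lambda>n. of_real (2 / (real (n + 2) - real (n + 1) * \<beta>)) * z ^ (n + 2))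
      sums (f_tilde \<beta> z - z)" if "z \<in> ball 0 1" for z
    unfolding f_tilde_def add_diff_cancel_left'
    by (rule summable_sums, rule f_tilde_summable[OF assms]) (use that in simp)
  then have "\<exists>a :: nat \<Rightarrow> complex. \<forall>z\<in>ball 0 1.
      (\<lambda>n. a (n + 2) * z ^ (n + 2)) sums (f_tilde \<beta> z - z)"
    by (intro exI[of _ "\<lambda>n. of_real (2 / (real n - real (n - 1) * \<beta>))"]) simp
  ultimately have "f_tilde \<beta> \<in> class_A"
    by (simp add: class_A_def)
  moreover have "0 < Re (euler_op (1 - \<beta>) ?G z)" if z: "z \<in> ball 0 1" for z
  proof -
    have "(1 + z) / (1 - z) = (1 + z) * cnj (1 - z) / of_real ((cmod (1 - z))\<^sup>2)"
      by (subst complex_div_cnj) simp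
    then have "Re ((1 + z) / (1 - z)) = Re ((1 + z) * cnj (1 - z)) / (cmod (1 - z))\<^sup>2"
      by (simp only: Re_divide_of_real)
    moreover have "Re ((1 + z) * cnj (1 - z)) = 1 - (cmod z)\<^sup>2"
      unfolding cmod_power2 by (simp add: power2_eq_square algebra_simps)
    moreover have "(cmod z)\<^sup>2 < 1"
      using z by (simp add: power_less_one_iff abs_square_less_1)
    moreover have "0 < (cmod (1 - z))\<^sup>2"
      using z by auto
    ultimately show ?thesis
      using euler_op_extremal_quotient[of "1 - \<beta>" z] assms z by simp
  qed
  then have "0 < Re (of_real \<beta> * (if z = 0 then 1 else f_tilde \<beta> z / z)
      + of_real (1 - \<beta>) * deriv (f_tilde \<beta>) z)" if "z \<in> ball 0 1" for z
    using that by (simp only: class_expression_eq_euler_op[OF hol extremal_quotient_0 eq])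
  ultimately show ?thesis
    unfolding class_A_beta_def by blast
qed

section \<open>Estimates and sharpness\<close>

text \<open>Writing \<open>z = r * u\<close> with \<open>cmod u = 1\<close>, the point \<open>z\<close> is rotated to the positive radius, where
  the positivity principle lives. For the upper bound a second rotation \<open>c\<close> makes \<open>c * g z\<close> equal
  to \<open>cmod (g z)\<close>, so that a bound of a real part suffices.\<close>

lemma caratheodory_transfer:
  assumes hol: "g holomorphic_on ball 0 1" and "g 0 = 1" and \<gamma>: "0 \<le> \<gamma>"
    and pos: "\<And>z. z \<in> ball 0 1 \<Longrightarrow> 0 < Re (euler_op \<gamma> g z)"
    and r: "0 < r" "r < 1" and z: "cmod z = r"
  shows "Re (extremal_quotient \<gamma> (of_real (- r))) \<le> Re (g z)"
    and "cmod (g z) \<le> Re (extremal_quotient \<gamma> (of_real r))"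
proof -
  let ?G = "extremal_quotient \<gamma>"
  have G: "?G holomorphic_on ball 0 1"
    using \<gamma> by (rule extremal_quotient_holomorphic)
  define u where "u = z / of_real r"
  have u: "cmod u = 1" "z = u * of_real r"
    using z r by (auto simp: u_def norm_divide)
  have p_hol: "euler_op \<gamma> g holomorphic_on ball 0 1"
    unfolding euler_op_def using hol by (intro holomorphic_intros holomorphic_deriv) auto
  have p0: "euler_op \<gamma> g 0 = 1"
    using \<open>g 0 = 1\<close> by (simp add: euler_op_def)
  have upper: "cmod (euler_op \<gamma> g (u * of_real t)) \<le> (1 + t) / (1 - t)"
    and lower: "(1 - t) / (1 + t) \<le> Re (euler_op \<gamma> g (u * of_real t))"
    if t: "t \<in> {0..r}" for t
  proof -
    have "cmod (u * of_real t) = t"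
      using u t by (simp add: norm_mult)
    then show "cmod (euler_op \<gamma> g (u * of_real t)) \<le> (1 + t) / (1 - t)"
      "(1 - t) / (1 + t) \<le> Re (euler_op \<gamma> g (u * of_real t))"
      using caratheodory_bounds[OF p_hol p0 pos, of "u * of_real t"] t r by auto
  qed
  have rot: "(\<lambda>w. c * g (u * w)) holomorphic_on ball 0 1" for c
    using holomorphic_on_ball_scale[OF hol] u by simp
  have euler_rot: "euler_op \<gamma> (\<lambda>w. c * g (u * w)) (of_real t)
      = c * euler_op \<gamma> g (u * of_real t)" if "t \<in> {0..r}" for c t
    by (rule euler_op_scale[OF hol]) (use u that r in \<open>auto simp: norm_mult\<close>)

  \<comment> \<open>The factors \<open>1\<close> and \<open>- 1\<close> give the two functions the shape \<open>c * q (u * w)\<close> of the rescaling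
    lemmas.\<close>
  have G_neg: "(\<lambda>w. 1 * ?G (- 1 * w)) holomorphic_on ball 0 1"
    by (rule holomorphic_on_ball_scale[OF G]) simp
  have "0 \<le> Re ((\<lambda>w. 1 * g (u * w) - 1 * ?G (- 1 * w)) (of_real r))"
  proof (rule Re_nonneg_of_euler_op)
    fix t assume t: "t \<in> {0..r}"
    have "euler_op \<gamma> (\<lambda>w. 1 * ?G (- 1 * w)) (of_real t) = 1 * euler_op \<gamma> ?G (- 1 * of_real t)"
      by (rule euler_op_scale[OF G]) (use t r in auto)
    also have "\<dots> = of_real ((1 - t) / (1 + t))"
      using t r \<gamma> by (simp add: euler_op_extremal_quotient)
    finally show "0 \<le> Re (euler_op \<gamma> (\<lambda>w. 1 * g (u * w) - 1 * ?G (- 1 * w)) (of_real t))"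
      using euler_op_diff[OF rot[of 1] G_neg, of "of_real t"] euler_rot[OF t, of 1] lower[OF t] t r
      by simp
  qed (use rot[of 1] G_neg \<gamma> r in \<open>auto intro: holomorphic_on_diff\<close>)
  then show "Re (?G (of_real (- r))) \<le> Re (g z)"
    by (simp add: u(2))

  define c where "c = (if g z = 0 then 1 else of_real (cmod (g z)) / g z)"
  have c: "cmod c = 1" "c * g z = of_real (cmod (g z))"
    by (auto simp: c_def norm_divide)
  have "0 \<le> Re ((\<lambda>w. ?G w - c * g (u * w)) (of_real r))"
  proof (rule Re_nonneg_of_euler_op)
    fix t assume t: "t \<in> {0..r}"
    have "Re (c * euler_op \<gamma> g (u * of_real t)) \<le> cmod (c * euler_op \<gamma> g (u * of_real t))"
      by (rule complex_Re_le_cmod)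
    also have "\<dots> \<le> (1 + t) / (1 - t)"
      using upper[OF t] c by (simp add: norm_mult)
    finally have le: "Re (c * euler_op \<gamma> g (u * of_real t)) \<le> (1 + t) / (1 - t)" .
    have "euler_op \<gamma> ?G (of_real t) = of_real ((1 + t) / (1 - t))"
      using t r \<gamma> by (simp add: euler_op_extremal_quotient)
    then show "0 \<le> Re (euler_op \<gamma> (\<lambda>w. ?G w - c * g (u * w)) (of_real t))"
      using euler_op_diff[OF G rot[of c], of "of_real t"] euler_rot[OF t, of c] le t r
      by simp
  qed (use rot[of c] G \<gamma> r in \<open>auto intro: holomorphic_on_diff\<close>)
  then have "0 \<le> Re (?G (of_real r) - c * g z)"
    by (simp only: u(2))
  then show "cmod (g z) \<le> Re (?G (of_real r))"
    by (simp only: c(2)) simp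
qed

text \<open>This determines the sign of \<open>f_tilde \<beta> (- r)\<close>, without which the lower bound for the modulus
  could not be seen to be attained. The reason is again positivity, since \<open>(1 - t) / (1 + t) > 0\<close>.\<close>

lemma extremal_quotient_neg_nonneg:
  assumes "0 \<le> \<gamma>" "0 \<le> r" "r < 1"
  shows "0 \<le> Re (extremal_quotient \<gamma> (of_real (- r)))"
proof -
  let ?G = "extremal_quotient \<gamma>"
  have G: "?G holomorphic_on ball 0 1"
    using assms(1) by (rule extremal_quotient_holomorphic)
  have "0 \<le> Re ((\<lambda>w. 1 * ?G (- 1 * w)) (of_real r))"
  proof (rule Re_nonneg_of_euler_op)
    show "(\<lambda>w. 1 * ?G (- 1 * w)) holomorphic_on ball 0 1"
      by (rule holomorphic_on_ball_scale[OF G]) simp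
    fix t assume t: "t \<in> {0..r}"
    have "euler_op \<gamma> (\<lambda>w. 1 * ?G (- 1 * w)) (of_real t) = 1 * euler_op \<gamma> ?G (- 1 * of_real t)"
      by (rule euler_op_scale[OF G]) (use t assms in auto)
    also have "\<dots> = of_real ((1 - t) / (1 + t))"
      using t assms by (simp add: euler_op_extremal_quotient)
    finally show "0 \<le> Re (euler_op \<gamma> (\<lambda>w. 1 * ?G (- 1 * w)) (of_real t))"
      using t assms by simp
  qed (use assms in auto)
  then show ?thesis
    by simp
qed

lemma class_A_beta_bounds:
  assumes \<beta>: "\<beta> \<in> {0..1}" and r: "0 < r" "r < 1" and f: "f \<in> class_A_beta \<beta>" and z: "cmod z = r"
  shows "- Re (f_tilde \<beta> (of_real (- r))) / r \<le> Re (f z / z)"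
    and "cmod (f z) \<le> Re (f_tilde \<beta> (of_real r))"
proof -
  have "f \<in> class_A"
    using f by (simp add: class_A_beta_def)
  then obtain g where g: "g holomorphic_on ball 0 1" "g 0 = 1"
    "\<And>z. z \<in> ball 0 1 \<Longrightarrow> f z = z * g z"
    using class_A_quotient by blast
  have "0 < Re (euler_op (1 - \<beta>) g w)" if "w \<in> ball 0 1" for w
  proof -
    have "0 < Re (of_real \<beta> * (if w = 0 then 1 else f w / w) + of_real (1 - \<beta>) * deriv f w)"
      using f that unfolding class_A_beta_def by blast
    then show ?thesis
      by (simp only: class_expression_eq_euler_op[OF g that])
  qed
  then have "Re (extremal_quotient (1 - \<beta>) (of_real (- r))) \<le> Re (g z)"
    and "cmod (g z) \<le> Re (extremal_quotient (1 - \<beta>) (of_real r))"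
    using caratheodory_transfer[OF g(1,2), of "1 - \<beta>" r z] \<beta> r z by auto
  moreover have "f z = z * g z" "z \<noteq> 0"
    using g(3)[of z] z r by auto
  ultimately show "- Re (f_tilde \<beta> (of_real (- r))) / r \<le> Re (f z / z)"
    and "cmod (f z) \<le> Re (f_tilde \<beta> (of_real r))"
    using \<beta> r z by (auto simp: f_tilde_eq norm_mult)
qed

theorem theorem5p1:
  fixes \<beta> r :: real
  assumes "\<beta> \<in> {0..1}" and "0 < r" and "r < 1"
  shows
    "(\<forall>f\<in>class_A_beta \<beta>. \<forall>z. cmod z = r \<longrightarrow>
        - Re (f_tilde \<beta> (of_real (- r))) / r \<le> Re (f z / z) \<and>
        Re (f z / z) \<le> Re (f_tilde \<beta> (of_real r)) / r \<and>
        - Re (f_tilde \<beta> (of_real (- r))) \<le> cmod (f z) \<and>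
        cmod (f z) \<le> Re (f_tilde \<beta> (of_real r))) \<and>
     (\<exists>f\<in>class_A_beta \<beta>. \<exists>z. cmod z = r \<and> Re (f z / z) = - Re (f_tilde \<beta> (of_real (- r))) / r) \<and>
     (\<exists>f\<in>class_A_beta \<beta>. \<exists>z. cmod z = r \<and> Re (f z / z) = Re (f_tilde \<beta> (of_real r)) / r) \<and>
     (\<exists>f\<in>class_A_beta \<beta>. \<exists>z. cmod z = r \<and> cmod (f z) = - Re (f_tilde \<beta> (of_real (- r)))) \<and>
     (\<exists>f\<in>class_A_beta \<beta>. \<exists>z. cmod z = r \<and> cmod (f z) = Re (f_tilde \<beta> (of_real r)))"
proof (intro conjI ballI allI impI)
  fix f z
  assume f: "f \<in> class_A_beta \<beta>" and z: "cmod z = r"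
  show lower: "- Re (f_tilde \<beta> (of_real (- r))) / r \<le> Re (f z / z)"
    and upper: "cmod (f z) \<le> Re (f_tilde \<beta> (of_real r))"
    using class_A_beta_bounds[OF assms f z] by auto
  have quot: "cmod (f z / z) = cmod (f z) / r"
    using z by (simp add: norm_divide)
  have "Re (f z / z) \<le> cmod (f z) / r"
    using complex_Re_le_cmod[of "f z / z"] quot by simp
  moreover from this lower have "- Re (f_tilde \<beta> (of_real (- r))) / r \<le> cmod (f z) / r"
    by linarith
  moreover have "cmod (f z) / r \<le> Re (f_tilde \<beta> (of_real r)) / r"
    using upper \<open>0 < r\<close> by (simp add: divide_right_mono)
  ultimately show "Re (f z / z) \<le> Re (f_tilde \<beta> (of_real r)) / r"
    and "- Re (f_tilde \<beta> (of_real (- r))) \<le> cmod (f z)"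
    using \<open>0 < r\<close> divide_le_cancel[of _ r] by (blast intro: order_trans)+
next
  have mem: "f_tilde \<beta> \<in> class_A_beta \<beta>"
    using f_tilde_in_class[OF assms(1)] .
  have norms: "cmod (of_real (- r)) = r" "cmod (of_real r) = r"
    using \<open>0 < r\<close> by auto
  show "\<exists>f\<in>class_A_beta \<beta>. \<exists>z. cmod z = r \<and> Re (f z / z) = - Re (f_tilde \<beta> (of_real (- r))) / r"
    using mem norms by (intro bexI[of _ "f_tilde \<beta>"] exI[of _ "of_real (- r)"])
      (auto simp: Re_divide_of_real)
  show "\<exists>f\<in>class_A_beta \<beta>. \<exists>z. cmod z = r \<and> Re (f z / z) = Re (f_tilde \<beta> (of_real r)) / r"
    using mem norms by (intro bexI[of _ "f_tilde \<beta>"] exI[of _ "of_real r"])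
      (auto simp: Re_divide_of_real)
  have "Re (f_tilde \<beta> (of_real (- r))) \<le> 0"
    using f_tilde_eq[OF assms(1), of "of_real (- r)"] extremal_quotient_neg_nonneg[of "1 - \<beta>" r] assms
    by auto
  then have "cmod (f_tilde \<beta> (of_real (- r))) = - Re (f_tilde \<beta> (of_real (- r)))"
    using f_tilde_real[OF assms(1), of "- r"] assms norm_of_real
    by (metis abs_of_nonpos abs_minus abs_of_pos)
  then show "\<exists>f\<in>class_A_beta \<beta>. \<exists>z. cmod z = r \<and> cmod (f z) = - Re (f_tilde \<beta> (of_real (- r)))"
    using mem norms by blast
  \<comment> \<open>The upper bound applied to the extremal function itself shows that its value at \<open>r\<close> is
    nonnegative.\<close>
  have "cmod (f_tilde \<beta> (of_real r)) = Re (f_tilde \<beta> (of_real r))"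
    using class_A_beta_bounds(2)[OF assms mem norms(2)] complex_Re_le_cmod by (rule antisym)
  then show "\<exists>f\<in>class_A_beta \<beta>. \<exists>z. cmod z = r \<and> cmod (f z) = Re (f_tilde \<beta> (of_real r))"
    using mem norms by blast
qed

end
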